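(* Let $p,q\in\beta N$. The following conditions are equivalent: (i) $p\mathrel{\widetilde{\mid}}q$, i.e. for all $A\subseteq N$, $A\in p$ implies $\{m\in N:\exists a\in A\ \ a\mid m\}\in q$; (ii) $p\cap\mathcal{U}\subseteq q\cap\mathcal{U}$; (iii) $D(p)\subseteq D(q)$; (iv) $D(p)\subseteq q$.
   Context: $N=\{1,2,3,\dots\}$, $\mid$ is the usual divisibility relation on $N$, and $\beta N$ is the set of all ultrafilters on $N$. For $A\subseteq N$ and $n\in N$, $A/n=\{m\in N:mn\in A\}$. $\mathcal{U}=\{S\subseteq N:S\text{ is upward closed for }\mid\}$, i.e. the family of all $S\subseteq N$ such that $m\in S$ and $m\mid n$ imply $n\in S$. For $p\in\beta N$, $D(p)=\{A\subseteq N:\{n\in N:A/n=N\}\in p\}$. *)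

theory Defs
  imports Main
begin

text \<open>
  The library's type of filters allows the improper filter and has no predicate for
  ultrafilters, so ultrafilters on a set are taken in the classical way, as families of
  its subsets.
\<close>

definition ultrafilter_on :: "'a set \<Rightarrow> 'a set set \<Rightarrow> bool" where
  "ultrafilter_on X p \<longleftrightarrow>
     p \<subseteq> Pow X \<and> X \<in> p \<and> {} \<notin> p \<and>
     (\<forall>A\<in>p. \<forall>B\<in>p. A \<inter> B \<in> p) \<and>
     (\<forall>A\<in>p. \<forall>B. A \<subseteq> B \<and> B \<subseteq> X \<longrightarrow> B \<in> p) \<and>
     (\<forall>A. A \<subseteq> X \<longrightarrow> A \<in> p \<or> X - A \<in> p)"

definition Npos :: "nat set" where
  "Npos = {n. 1 \<le> n}"

definition betaN :: "nat set set set" where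
  "betaN = {p. ultrafilter_on Npos p}"

definition quot_set :: "nat set \<Rightarrow> nat \<Rightarrow> nat set" where
  "quot_set A n = {m \<in> Npos. m * n \<in> A}"

definition dvd_up_closed :: "nat set set" where
  "dvd_up_closed =
     {S. S \<subseteq> Npos \<and> (\<forall>m\<in>S. \<forall>n\<in>Npos. m dvd n \<longrightarrow> n \<in> S)}"

definition D_set :: "nat set set \<Rightarrow> nat set set" where
  "D_set p = {A. A \<subseteq> Npos \<and> {n \<in> Npos. quot_set A n = Npos} \<in> p}"

definition tilde_dvd :: "nat set set \<Rightarrow> nat set set \<Rightarrow> bool" where
  "tilde_dvd p q \<longleftrightarrow>
     (\<forall>A. A \<subseteq> Npos \<longrightarrow> A \<in> p \<longrightarrow> {m \<in> Npos. \<exists>a\<in>A. a dvd m} \<in> q)"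

end

theory Submission
  imports Defs
begin

text \<open>
  Every \<open>A \<subseteq> N\<close> lies between two sets that are upward closed for divisibility: the set of
  multiples of elements of \<open>A\<close>, which is the least upward closed set containing \<open>A\<close>, and
  \<open>{n. A/n = N}\<close>, which is the greatest one contained in \<open>A\<close>, because \<open>A/n = N\<close> says that
  every multiple of \<open>n\<close> is in \<open>A\<close>. Call them the closure and the core of \<open>A\<close>. The relation
  \<open>tilde_dvd p q\<close> says that \<open>q\<close> contains the closures of the members of \<open>p\<close>, and \<open>D(p)\<close>
  consists of the sets whose core is in \<open>p\<close>. Both operations fix the upward closed sets.
  Hence each of the four conditions asserts that the upward closed members of \<open>p\<close> belong
  to \<open>q\<close>: such a member is its own closure and its own core, so it is in \<open>D(p)\<close>;
  conversely, the closure of a member of \<open>p\<close> and the core of a member of \<open>D(p)\<close> are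
  upward closed members of \<open>p\<close>, and a set whose core is in \<open>q\<close> is itself in \<open>q\<close>.
\<close>

definition dvd_closure :: "nat set \<Rightarrow> nat set" where
  "dvd_closure A = {m \<in> Npos. \<exists>a\<in>A. a dvd m}"

definition dvd_core :: "nat set \<Rightarrow> nat set" where
  "dvd_core A = {n \<in> Npos. quot_set A n = Npos}"

lemma betaN_superset:
  assumes "p \<in> betaN" "A \<in> p" "A \<subseteq> B" "B \<subseteq> Npos"
  shows "B \<in> p"
proof -
  have "\<forall>A\<in>p. \<forall>B. A \<subseteq> B \<and> B \<subseteq> Npos \<longrightarrow> B \<in> p"
    using assms(1) by (simp add: betaN_def ultrafilter_on_def)
  with assms(2-4) show ?thesis
    by blast
qed

lemma betaN_subset_Npos:
  assumes "p \<in> betaN" "A \<in> p"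
  shows "A \<subseteq> Npos"
proof -
  have "p \<subseteq> Pow Npos"
    using assms(1) by (simp add: betaN_def ultrafilter_on_def)
  with assms(2) show ?thesis
    by blast
qed

lemma subset_dvd_closure: "A \<subseteq> Npos \<Longrightarrow> A \<subseteq> dvd_closure A"
  unfolding dvd_closure_def by (blast intro: dvd_refl)

lemma dvd_closure_up_closed: "dvd_closure A \<in> dvd_up_closed"
  unfolding dvd_closure_def dvd_up_closed_def by (blast intro: dvd_trans)

lemma dvd_closure_eq: "S \<in> dvd_up_closed \<Longrightarrow> dvd_closure S = S"
  unfolding dvd_closure_def dvd_up_closed_def by (blast intro: dvd_refl)

lemma mem_dvd_core_iff:
  "n \<in> dvd_core A \<longleftrightarrow> n \<in> Npos \<and> (\<forall>k\<in>Npos. n dvd k \<longrightarrow> k \<in> A)"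
proof -
  have "quot_set A n = Npos \<longleftrightarrow> (\<forall>k\<in>Npos. n dvd k \<longrightarrow> k \<in> A)" if n: "n \<in> Npos"
  proof
    assume quot: "quot_set A n = Npos"
    show "\<forall>k\<in>Npos. n dvd k \<longrightarrow> k \<in> A"
    proof (intro ballI impI)
      fix k assume k: "k \<in> Npos" "n dvd k"
      then obtain m where m: "k = m * n"
        by (metis dvd_def mult.commute)
      \<comment> \<open>The cofactor is nonzero, so the hypothesis on \<open>A/n\<close> applies to it.\<close>
      with k have "m \<in> Npos"
        by (cases m) (auto simp: Npos_def)
      with quot m show "k \<in> A"
        by (auto simp: quot_set_def)
    qed
  next
    assume "\<forall>k\<in>Npos. n dvd k \<longrightarrow> k \<in> A"
    with n show "quot_set A n = Npos"
      by (auto simp: quot_set_def Npos_def)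
  qed
  then show ?thesis
    by (auto simp: dvd_core_def)
qed

lemma dvd_core_subset: "dvd_core A \<subseteq> A"
  by (auto simp: mem_dvd_core_iff)

lemma dvd_core_up_closed: "dvd_core A \<in> dvd_up_closed"
proof -
  have "dvd_core A \<subseteq> Npos"
    by (auto simp: mem_dvd_core_iff)
  moreover have "n \<in> dvd_core A" if "m \<in> dvd_core A" "n \<in> Npos" "m dvd n" for m n
    using that unfolding mem_dvd_core_iff by (meson dvd_trans)
  ultimately show ?thesis
    unfolding dvd_up_closed_def by blast
qed

lemma dvd_core_eq: "S \<in> dvd_up_closed \<Longrightarrow> dvd_core S = S"
  unfolding dvd_up_closed_def by (auto simp: mem_dvd_core_iff)

lemma mem_D_set_iff: "A \<in> D_set p \<longleftrightarrow> A \<subseteq> Npos \<and> dvd_core A \<in> p"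
  by (simp add: D_set_def dvd_core_def)

lemma tilde_dvd_iff:
  "tilde_dvd p q \<longleftrightarrow> (\<forall>A. A \<subseteq> Npos \<longrightarrow> A \<in> p \<longrightarrow> dvd_closure A \<in> q)"
  by (simp add: tilde_dvd_def dvd_closure_def)

lemma D_set_subset:
  assumes "q \<in> betaN"
  shows "D_set q \<subseteq> q"
  using betaN_superset[OF assms] dvd_core_subset by (auto simp: mem_D_set_iff)

theorem theorem6p2:
  fixes p q :: "nat set set"
  assumes "p \<in> betaN" and "q \<in> betaN"
  shows "(tilde_dvd p q \<longleftrightarrow> p \<inter> dvd_up_closed \<subseteq> q \<inter> dvd_up_closed) \<and>
         (p \<inter> dvd_up_closed \<subseteq> q \<inter> dvd_up_closed \<longleftrightarrow> D_set p \<subseteq> D_set q) \<and>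
         (D_set p \<subseteq> D_set q \<longleftrightarrow> D_set p \<subseteq> q)"
proof -
  have i_ii: "p \<inter> dvd_up_closed \<subseteq> q \<inter> dvd_up_closed" if "tilde_dvd p q"
  proof
    fix S assume S: "S \<in> p \<inter> dvd_up_closed"
    with that assms(1) have "dvd_closure S \<in> q"
      by (auto simp: tilde_dvd_iff dest: betaN_subset_Npos)
    with S show "S \<in> q \<inter> dvd_up_closed"
      by (simp add: dvd_closure_eq)
  qed
  have ii_iii: "D_set p \<subseteq> D_set q" if "p \<inter> dvd_up_closed \<subseteq> q \<inter> dvd_up_closed"
    using that dvd_core_up_closed by (auto simp: mem_D_set_iff)
  have iii_iv: "D_set p \<subseteq> q" if "D_set p \<subseteq> D_set q"
    using that D_set_subset[OF assms(2)] by blast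
  have iv_i: "tilde_dvd p q" if "D_set p \<subseteq> q"
    unfolding tilde_dvd_iff
  proof (intro allI impI)
    fix A assume A: "A \<subseteq> Npos" "A \<in> p"
    have closed: "dvd_closure A \<in> dvd_up_closed"
      by (rule dvd_closure_up_closed)
    then have "dvd_closure A \<subseteq> Npos"
      by (simp add: dvd_up_closed_def)
    moreover from this have "dvd_closure A \<in> p"
      using betaN_superset[OF assms(1)] A subset_dvd_closure by blast
    \<comment> \<open>An upward closed member of \<open>p\<close> is its own core, hence lies in \<open>D(p)\<close>.\<close>
    ultimately have "dvd_closure A \<in> D_set p"
      by (simp add: mem_D_set_iff dvd_core_eq[OF closed])
    with that show "dvd_closure A \<in> q"
      by blast
  qed
  from i_ii ii_iii iii_iv iv_i show ?thesis
    by blast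
qed

end
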